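(* Let $k, l \geq 1$ be integers. Suppose that some set $E_0$ of edges of the Cartesian product $C_{2k+1} \square C_{2l+1}$ is precolored using colors from a set of at most $5$ colors, such that the distance between any two edges of $E_0$ is at least three. Then this precoloring is extendable, i.e. there is a proper edge coloring of $C_{2k+1} \square C_{2l+1}$ with $\chi'(C_{2k+1} \square C_{2l+1})$ colors in which every edge of $E_0$ receives its prescribed color.
   Context: $C_n$ is the cycle on $n$ vertices. The Cartesian product $G \square H$ has vertex set $V(G)\times V(H)$, with $(u_1,u_2)$ adjacent to $(v_1,v_2)$ iff either $u_1=v_1$ and $u_2v_2 \in E(H)$, or $u_2=v_2$ and $u_1v_1\in E(G)$. The distance between vertices is the length of a shortest path between them, and the distance between edges $xy$ and $zw$ is $\min\{d(x,z),d(x,w),d(y,z),d(y,w)\}$. $\chi'$ denotes the chromatic index. *)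

theory Defs
  imports Main
begin

text \<open>Simple graphs given by a vertex set and a symmetric irreflexive adjacency relation.\<close>

definition cycle_adj :: "nat \<Rightarrow> nat \<Rightarrow> nat \<Rightarrow> bool" where
  "cycle_adj n i j \<longleftrightarrow> i < n \<and> j < n \<and> i \<noteq> j \<and> (j = (i + 1) mod n \<or> i = (j + 1) mod n)"

definition cart_adj :: "('a \<Rightarrow> 'a \<Rightarrow> bool) \<Rightarrow> ('b \<Rightarrow> 'b \<Rightarrow> bool) \<Rightarrow> 'a \<times> 'b \<Rightarrow> 'a \<times> 'b \<Rightarrow> bool" where
  "cart_adj G H u v \<longleftrightarrow> (fst u = fst v \<and> H (snd u) (snd v)) \<or> (snd u = snd v \<and> G (fst u) (fst v))"

definition torus_verts :: "nat \<Rightarrow> nat \<Rightarrow> (nat \<times> nat) set" where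
  "torus_verts n m = {0..<n} \<times> {0..<m}"

definition torus_adj :: "nat \<Rightarrow> nat \<Rightarrow> nat \<times> nat \<Rightarrow> nat \<times> nat \<Rightarrow> bool" where
  "torus_adj n m = cart_adj (cycle_adj n) (cycle_adj m)"

definition graph_edges :: "'v set \<Rightarrow> ('v \<Rightarrow> 'v \<Rightarrow> bool) \<Rightarrow> 'v set set" where
  "graph_edges V adj = {{u, v} | u v. u \<in> V \<and> v \<in> V \<and> adj u v}"

definition graph_dist :: "('v \<Rightarrow> 'v \<Rightarrow> bool) \<Rightarrow> 'v \<Rightarrow> 'v \<Rightarrow> nat" where
  "graph_dist adj u v = (LEAST n. (adj ^^ n) u v)"

definition edge_dist :: "('v \<Rightarrow> 'v \<Rightarrow> bool) \<Rightarrow> 'v set \<Rightarrow> 'v set \<Rightarrow> nat" where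
  "edge_dist adj e f = Min {graph_dist adj x y | x y. x \<in> e \<and> y \<in> f}"

definition proper_edge_coloring :: "'v set set \<Rightarrow> ('v set \<Rightarrow> 'c) \<Rightarrow> bool" where
  "proper_edge_coloring E c \<longleftrightarrow> (\<forall>e\<in>E. \<forall>f\<in>E. e \<noteq> f \<and> e \<inter> f \<noteq> {} \<longrightarrow> c e \<noteq> c f)"

definition chromatic_index :: "'v set set \<Rightarrow> nat" where
  "chromatic_index E = (LEAST k. \<exists>c :: 'v set \<Rightarrow> nat. proper_edge_coloring E c \<and> c ` E \<subseteq> {..<k})"

end

theory Submission
  imports Defs
begin

text \<open>
  The torus is 4-regular of odd order, so four matchings cannot cover its edges and the chromatic
  index is at least 5. Conversely, the torus has a proper 5-coloring in which one colour occurs only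
  on a prescribed edge and on the opposite edge of one 4-cycle through it. Prescribe an edge
  \<open>e1\<close> of \<open>E0\<close> and rename the colours so that this rare colour is
  \<open>\<phi> e1\<close>: it is then absent around every other edge of \<open>E0\<close>. Any such edge
  \<open>e\<close> of the wrong colour can be given the colour \<open>\<phi> e\<close>, its neighbours of that
  colour receiving the rare one, and these changes do not interfere by the distance condition.
\<close>

section \<open>Local recolouring around the precolored edges\<close>

text \<open>\<open>sep\<close> keeps the changes made for different members of \<open>E0\<close>
  apart, and \<open>spare\<close> keeps the old occurrences of \<open>z\<close> away from every
  change. Distinct edges sent to \<open>z\<close> for the same member shared a colour under
  \<open>b\<close>, so they are already disjoint.\<close>

lemma recolour:
  fixes E E0 :: "'v set set" and b \<phi> :: "'v set \<Rightarrow> 'c"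
  assumes b: "proper_edge_coloring E b" and sub: "E0 \<subseteq> E"
    and sep: "\<And>e e' g g'. \<lbrakk>e \<in> E0; e' \<in> E0; e \<noteq> e'; g \<in> E; g' \<in> E; g \<inter> e \<noteq> {}; g' \<inter> e' \<noteq> {}\<rbrakk>
      \<Longrightarrow> g \<inter> g' = {}"
    and spare: "\<And>g e g'. \<lbrakk>g \<in> E; b g = z; e \<in> E0; b e \<noteq> \<phi> e; g' \<in> E; g' \<inter> e \<noteq> {}\<rbrakk> \<Longrightarrow> g \<inter> g' = {}"
  obtains c where "proper_edge_coloring E c" "\<forall>e\<in>E0. c e = \<phi> e" "c ` E \<subseteq> insert z (b ` E \<union> \<phi> ` E0)"
proof -
  \<comment> \<open>Here \<open>e\<close> must give up its colour because the wrongly colored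
    \<open>e'\<close> needs it. The last two conjuncts exclude \<open>e = e'\<close>.\<close>
  define R where "R e' e \<longleftrightarrow> e' \<in> E0 \<and> e \<inter> e' \<noteq> {} \<and> b e = \<phi> e' \<and> b e' \<noteq> \<phi> e'" for e' e
  define c where "c e = (if e \<in> E0 then \<phi> e else if \<exists>e'. R e' e then z else b e)" for e
  have b_neq: "b e \<noteq> b f" if "e \<in> E" "f \<in> E" "e \<noteq> f" "e \<inter> f \<noteq> {}" for e f
    using b that unfolding proper_edge_coloring_def by blast
  have pre: "c e \<noteq> c f" if "e \<in> E0" "f \<in> E" "f \<notin> E0" "e \<inter> f \<noteq> {}" for e f
  proof (cases "\<exists>e'. R e' f")
    case True
    then obtain e' where e': "R e' f" by blast
    have "e' = e"
      using sep[of e' e f f] e' that unfolding R_def by blast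
    \<comment> \<open>As \<open>b f\<close> equals \<open>\<phi> e\<close>, this separates the new
      colour \<open>z\<close> of \<open>f\<close> from the colour of \<open>e\<close>.\<close>
    moreover have "b f \<noteq> z"
      using spare[of f e e] \<open>e' = e\<close> e' that sub unfolding R_def by blast
    ultimately show ?thesis
      using True e' that by (auto simp: c_def R_def)
  next
    case False
    then have "c f = b f" using that by (simp add: c_def)
    moreover have "b f \<noteq> \<phi> e"
      using False b_neq[of e f] that sub unfolding R_def by (metis Int_commute subsetD)
    ultimately show ?thesis using that by (simp add: c_def)
  qed
  have mixed: "c e \<noteq> c f"
    if "e \<in> E" "f \<in> E" "e \<notin> E0" "f \<notin> E0" "e \<inter> f \<noteq> {}" "R e' e" "\<nexists>f'. R f' f" for e f e'
  proof -
    have "b f \<noteq> z" using spare[of f e' e] that unfolding R_def by blast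
    then show ?thesis using that by (auto simp: c_def)
  qed
  have "c e \<noteq> c f" if ef: "e \<in> E" "f \<in> E" "e \<noteq> f" "e \<inter> f \<noteq> {}" for e f
  proof -
    consider "e \<in> E0" "f \<in> E0" | "e \<in> E0" "f \<notin> E0" | "e \<notin> E0" "f \<in> E0" | "e \<notin> E0" "f \<notin> E0"
      by blast
    then show ?thesis
    proof cases
      case 1
      then show ?thesis using sep[of e f e f] ef by blast
    next
      case 2
      then show ?thesis using pre ef by blast
    next
      case 3
      then show ?thesis using pre[of f e] ef by (metis Int_commute)
    next
      case 4
      consider e' f' where "R e' e" "R f' f" | e' where "R e' e" "\<nexists>f'. R f' f"
        | f' where "R f' f" "\<nexists>e'. R e' e" | "\<nexists>e'. R e' e" "\<nexists>f'. R f' f"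
        by blast
      then show ?thesis
      proof cases
        case 1
        then have "e' = f'" using sep[of e' f' e f] ef unfolding R_def by blast
        then have "b e = b f" using 1 unfolding R_def by simp
        then show ?thesis using b_neq ef by blast
      next
        case 2
        then show ?thesis using mixed 4 ef by blast
      next
        case 3
        then show ?thesis using mixed[of f e] 4 ef by (metis Int_commute)
      next
        case none: 4
        then show ?thesis using 4 b_neq[OF ef] by (simp add: c_def)
      qed
    qed
  qed
  then have "proper_edge_coloring E c" by (auto simp: proper_edge_coloring_def)
  then show ?thesis by (rule that) (auto simp: c_def)
qed

section \<open>Edges of the torus in coordinates\<close>

abbreviation torus_edges :: "nat \<Rightarrow> nat \<Rightarrow> (nat \<times> nat) set set" where
  "torus_edges m n \<equiv> graph_edges (torus_verts m n) (torus_adj m n)"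

text \<open>An edge is coded by its direction and the endpoint from which it steps forward;
  \<open>True\<close> moves the first coordinate. Every edge then has a single code once both cycles
  have length at least 3.\<close>

fun torus_edge :: "nat \<Rightarrow> nat \<Rightarrow> bool \<times> nat \<times> nat \<Rightarrow> (nat \<times> nat) set" where
  "torus_edge m n (True, i, j) = {(i, j), (Suc i mod m, j)}"
| "torus_edge m n (False, i, j) = {(i, j), (i, Suc j mod n)}"

lemma Suc_mod_eq: "i < m \<Longrightarrow> Suc i mod m = (if Suc i = m then 0 else Suc i)"
  by (auto simp: Suc_lessI)

lemma torus_edges_eq:
  assumes "3 \<le> m" "3 \<le> n"
  shows "torus_edges m n = torus_edge m n ` (UNIV \<times> {..<m} \<times> {..<n})"
proof (intro equalityI subsetI)
  fix e assume "e \<in> torus_edges m n"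
  then obtain i j i' j' where e: "e = {(i, j), (i', j')}" "i < m" "j < n" "i' < m" "j' < n"
    and "torus_adj m n (i, j) (i', j')"
    by (auto simp: graph_edges_def torus_verts_def)
  then consider "i = i'" "j' = Suc j mod n" | "i = i'" "j = Suc j' mod n"
    | "j = j'" "i' = Suc i mod m" | "j = j'" "i = Suc i' mod m"
    by (auto simp: torus_adj_def cart_adj_def cycle_adj_def)
  then show "e \<in> torus_edge m n ` (UNIV \<times> {..<m} \<times> {..<n})"
  proof cases
    case 1
    then show ?thesis using e by (intro image_eqI[of _ _ "(False, i, j)"]) auto
  next
    case 2
    then show ?thesis using e by (intro image_eqI[of _ _ "(False, i, j')"]) auto
  next
    case 3
    then show ?thesis using e by (intro image_eqI[of _ _ "(True, i, j)"]) auto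
  next
    case 4
    then show ?thesis using e by (intro image_eqI[of _ _ "(True, i', j)"]) auto
  qed
next
  fix e assume "e \<in> torus_edge m n ` (UNIV \<times> {..<m} \<times> {..<n})"
  then obtain d i j where d: "e = torus_edge m n (d, i, j)" "i < m" "j < n" by auto
  have "i \<noteq> Suc i mod m" "j \<noteq> Suc j mod n" using assms d by (auto simp: Suc_mod_eq)
  define v where "v = (if d then (Suc i mod m, j) else (i, Suc j mod n))"
  have "e = {(i, j), v}" "v \<in> torus_verts m n" "torus_adj m n (i, j) v"
    using d \<open>i \<noteq> Suc i mod m\<close> \<open>j \<noteq> Suc j mod n\<close>
    by (cases d; simp add: v_def torus_verts_def torus_adj_def cart_adj_def cycle_adj_def)+
  moreover have "(i, j) \<in> torus_verts m n" using d by (simp add: torus_verts_def)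
  ultimately show "e \<in> torus_edges m n" unfolding graph_edges_def by blast
qed

text \<open>The bound 3 matters: in a cycle of length 2 the forward steps from 0 and from 1 would be
  the same edge.\<close>

lemma inj_on_torus_edge:
  assumes "3 \<le> m" "3 \<le> n"
  shows "inj_on (torus_edge m n) (UNIV \<times> {..<m} \<times> {..<n})"
proof (rule inj_onI)
  fix s t :: "bool \<times> nat \<times> nat"
  assume "s \<in> UNIV \<times> {..<m} \<times> {..<n}" "t \<in> UNIV \<times> {..<m} \<times> {..<n}" "torus_edge m n s = torus_edge m n t"
  then show "s = t"
    using assms
    by (cases "(m, n, s)" rule: torus_edge.cases; cases "(m, n, t)" rule: torus_edge.cases)
      (auto simp: doubleton_eq_iff Suc_mod_eq split: if_splits)
qed

definition cyc_pred :: "nat \<Rightarrow> nat \<Rightarrow> nat" where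
  "cyc_pred m i = (if i = 0 then m - 1 else i - 1)"

text \<open>Reduces properness of a coloring to comparing four colours at each vertex.\<close>

lemma torus_edge_incident:
  assumes "(x, y) \<in> torus_edge m n (d, i, j)" "i < m" "j < n"
  shows "(d, i, j) \<in> {(True, x, y), (True, cyc_pred m x, y), (False, x, y), (False, x, cyc_pred n y)}"
  using assms by (cases d) (auto simp: cyc_pred_def Suc_mod_eq split: if_splits)

lemma finite_torus_edges: "3 \<le> m \<Longrightarrow> 3 \<le> n \<Longrightarrow> finite (torus_edges m n)"
  by (simp add: torus_edges_eq)

lemma card_torus_edges: "3 \<le> m \<Longrightarrow> 3 \<le> n \<Longrightarrow> card (torus_edges m n) = 2 * (m * n)"
  by (simp add: torus_edges_eq card_image[OF inj_on_torus_edge] card_cartesian_product)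

lemma card_torus_edge: "e \<in> torus_edges m n \<Longrightarrow> card e = 2"
  by (auto simp: graph_edges_def torus_adj_def cart_adj_def cycle_adj_def card_2_iff)

lemma torus_edge_subset: "e \<in> torus_edges m n \<Longrightarrow> e \<subseteq> torus_verts m n"
  by (auto simp: graph_edges_def)

section \<open>Lower bound for the chromatic index\<close>

text \<open>Each colour class is a matching and misses a vertex, as \<open>m * n\<close> is odd.
  Summing over the classes gives \<open>4 * (m * n) \<le> q * (m * n - 1)\<close>, which fails for
  \<open>q \<le> 4\<close>.\<close>

lemma five_le_of_proper_torus_coloring:
  fixes c :: "(nat \<times> nat) set \<Rightarrow> nat"
  assumes mn: "3 \<le> m" "3 \<le> n" "odd m" "odd n"
    and c: "proper_edge_coloring (torus_edges m n) c" "c ` torus_edges m n \<subseteq> {..<q}"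
  shows "5 \<le> q"
proof (rule ccontr)
  assume "\<not> 5 \<le> q"
  let ?E = "torus_edges m n"
  define M where "M a = {e \<in> ?E. c e = a}" for a
  have fin: "finite ?E" using finite_torus_edges mn by blast
  have "2 * card (M a) \<le> m * n - 1" for a
  proof -
    have "card (\<Union> (M a)) = (\<Sum>e\<in>M a. card e)"
    proof (rule card_Union_disjoint)
      show "pairwise disjnt (M a)"
        using c(1) by (auto simp: M_def pairwise_def disjnt_def proper_edge_coloring_def)
      show "finite e" if "e \<in> M a" for e
        using that card_torus_edge by (auto simp: M_def intro: card_ge_0_finite)
    qed
    also have "\<dots> = (\<Sum>e\<in>M a. 2)"
      using card_torus_edge by (intro sum.cong) (auto simp: M_def)
    finally have "card (\<Union> (M a)) = 2 * card (M a)" by simp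
    moreover have "card (\<Union> (M a)) \<le> card (torus_verts m n)"
      using torus_edge_subset by (intro card_mono) (auto simp: M_def torus_verts_def)
    ultimately have "2 * card (M a) \<le> m * n" by (simp add: torus_verts_def)
    moreover have "odd (m * n)" using mn by simp
    ultimately show ?thesis by (metis even_mult_iff even_numeral le_neq_implies_less less_imp_le_nat
      Suc_pred' odd_pos less_Suc_eq_le)
  qed
  then have le: "2 * (\<Sum>a<q. card (M a)) \<le> q * (m * n - 1)"
    using sum_bounded_above[of "{..<q}" "\<lambda>a. 2 * card (M a)" "m * n - 1"]
    by (simp add: sum_distrib_left)
  have "?E = (\<Union>a<q. M a)" using c(2) by (auto simp: M_def)
  then have "card ?E = card (\<Union>a<q. M a)" by simp
  also have "\<dots> = (\<Sum>a<q. card (M a))"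
    using fin by (intro card_UN_disjoint) (auto simp: M_def)
  finally have "4 * (m * n) \<le> q * (m * n - 1)"
    using le card_torus_edges mn by simp
  also have "\<dots> \<le> 4 * (m * n - 1)"
    using \<open>\<not> 5 \<le> q\<close> by (intro mult_right_mono) auto
  finally show False using mn by (cases "m * n") auto
qed

section \<open>Colorings with a rare colour near one edge\<close>

text \<open>The last clause confines the rare colour 4 to vertices at distance at most 1 from
  \<open>e\<close>. It is phrased through an edge \<open>h\<close> meeting \<open>e\<close> so that
  the separation of precolored edges applies directly.\<close>

definition focused_coloring :: "'v set set \<Rightarrow> 'v set \<Rightarrow> ('v set \<Rightarrow> nat) \<Rightarrow> bool" where
  "focused_coloring E e b \<longleftrightarrow> proper_edge_coloring E b \<and> b ` E \<subseteq> {..<5} \<and> b e = 4 \<and>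
     (\<forall>g\<in>E. b g = 4 \<longrightarrow> (\<forall>x\<in>g. \<exists>h\<in>E. x \<in> h \<and> h \<inter> e \<noteq> {}))"

text \<open>Pulling back along a graph isomorphism preserves incidences, so one coloring serves all
  edges equivalent under symmetries.\<close>

lemma focused_coloring_transfer:
  assumes b: "focused_coloring E' (\<sigma> ` e) b" and e: "e \<in> E"
    and E': "(`) \<sigma> ` E = E'" and inj: "inj_on \<sigma> (\<Union>E)"
  shows "focused_coloring E e (b \<circ> (`) \<sigma>)"
proof -
  have meet: "\<sigma> ` f \<inter> \<sigma> ` g = {} \<longleftrightarrow> f \<inter> g = {}" if "f \<in> E" "g \<in> E" for f g
    using inj_on_image_Int[OF inj, of f g] that by (metis Union_upper image_is_empty)
  have inj_E: "\<sigma> ` f = \<sigma> ` g \<longleftrightarrow> f = g" if "f \<in> E" "g \<in> E" for f g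
    using inj_on_image_eq_iff[OF inj, of f g] that by blast
  have mem: "\<sigma> x \<in> \<sigma> ` h \<longleftrightarrow> x \<in> h" if "x \<in> g" "g \<in> E" "h \<in> E" for x g h
    using inj_on_image_mem_iff[OF inj, of x h] that by blast
  have near: "\<exists>h\<in>E. x \<in> h \<and> h \<inter> e \<noteq> {}" if g: "g \<in> E" "b (\<sigma> ` g) = 4" "x \<in> g" for g x
  proof -
    have "\<sigma> ` g \<in> E'" "\<sigma> x \<in> \<sigma> ` g" using g E' by blast+
    then obtain h' where h': "h' \<in> E'" "\<sigma> x \<in> h'" "h' \<inter> \<sigma> ` e \<noteq> {}"
      using b g(2) unfolding focused_coloring_def by blast
    obtain h where h: "h \<in> E" "h' = \<sigma> ` h" using E' h'(1) by blast
    have "x \<in> h" using h h'(2) mem[OF g(3,1) h(1)] by simp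
    moreover have "h \<inter> e \<noteq> {}" using h h'(3) meet[OF h(1) e] by simp
    ultimately show ?thesis using h(1) by blast
  qed
  have "proper_edge_coloring E' b" using b unfolding focused_coloring_def by (elim conjE)
  then have b_neq: "b f' \<noteq> b g'" if "f' \<in> E'" "g' \<in> E'" "f' \<noteq> g'" "f' \<inter> g' \<noteq> {}" for f' g'
    using that unfolding proper_edge_coloring_def by blast
  have proper: "proper_edge_coloring E (b \<circ> (`) \<sigma>)"
    unfolding proper_edge_coloring_def o_apply
  proof (intro ballI impI)
    fix f g assume fg: "f \<in> E" "g \<in> E" "f \<noteq> g \<and> f \<inter> g \<noteq> {}"
    have "\<sigma> ` f \<in> E'" "\<sigma> ` g \<in> E'" using fg E' by blast+
    moreover have "\<sigma> ` f \<noteq> \<sigma> ` g" "\<sigma> ` f \<inter> \<sigma> ` g \<noteq> {}"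
      using fg meet[OF fg(1,2)] inj_E[OF fg(1,2)] by simp_all
    ultimately show "b (\<sigma> ` f) \<noteq> b (\<sigma> ` g)" by (rule b_neq)
  qed
  have "(b \<circ> (`) \<sigma>) ` E \<subseteq> {..<5}"
    using b unfolding focused_coloring_def E'[symmetric] image_comp by blast
  moreover have "(b \<circ> (`) \<sigma>) e = 4" using b unfolding focused_coloring_def o_apply by (elim conjE)
  moreover have "\<forall>g\<in>E. (b \<circ> (`) \<sigma>) g = 4 \<longrightarrow> (\<forall>x\<in>g. \<exists>h\<in>E. x \<in> h \<and> h \<inter> e \<noteq> {})"
    unfolding o_apply by (intro ballI impI near)
  ultimately show ?thesis
    unfolding focused_coloring_def using proper by (intro conjI)
qed

section \<open>An explicit coloring of odd tori\<close>

text \<open>Read as the label of the step from \<open>i\<close> to its successor, this is a proper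
  3-edge-coloring of an odd cycle.\<close>

definition cyc_class :: "nat \<Rightarrow> nat" where
  "cyc_class i = (if i = 0 then 0 else if odd i then 1 else 2)"

text \<open>
  A coloring of the 3 by 3 torus, extended by repeating its last row and column: in a pair of
  inserted columns the vertical edges copy column 2, and the horizontal ones alternate between the
  two edges at column 2. This keeps colour 4 on two edges, since it avoids the last row and column.
\<close>

fun torus_base :: "bool \<times> nat \<times> nat \<Rightarrow> nat" where
  "torus_base (True, i, j) = [[0,1,0],[2,0,1],[3,2,2]] ! cyc_class i ! min j 2"
| "torus_base (False, i, j) = [[4,3,1],[4,2,3],[1,3,0]] ! min i 2 ! cyc_class j"

text \<open>The triples list the labels of the outgoing and incoming step at \<open>i\<close> and
  the table column copied there, so only four local patterns occur per coordinate.\<close>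

lemma cyc_class_cases:
  assumes "3 \<le> m" "odd m" "i < m"
  shows "(cyc_class i, cyc_class (cyc_pred m i), min i 2) \<in> {(0,2,0), (1,0,1), (2,1,2), (1,2,2)}"
  using assms by (auto simp: cyc_class_def cyc_pred_def elim!: oddE)

text \<open>The four colours depend only on the local patterns of \<open>x\<close> and
  \<open>y\<close>, which leaves 16 table checks.\<close>

lemma torus_base_distinct:
  assumes "3 \<le> m" "3 \<le> n" "odd m" "odd n" "x < m" "y < n"
  shows "distinct (map torus_base
    [(True, x, y), (True, cyc_pred m x, y), (False, x, y), (False, x, cyc_pred n y)])"
  using cyc_class_cases[of m x] cyc_class_cases[of n y] assms by auto

lemma torus_base_eq_4:
  assumes "torus_base (d, i, j) = 4"
  shows "\<not> d \<and> j = 0 \<and> i \<le> 1"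
  using assms
  by (cases d) (auto simp: cyc_class_def min_def nth_Cons' split: if_splits)

lemma torus_base_less: "torus_base (d, i, j) < 5"
  by (cases d) (auto simp: cyc_class_def min_def nth_Cons' split: if_splits)

lemma focused_coloring_at_origin:
  assumes mn: "3 \<le> m" "3 \<le> n" "odd m" "odd n"
  obtains b where "focused_coloring (torus_edges m n) (torus_edge m n (False, 0, 0)) b"
proof -
  let ?I = "UNIV \<times> {..<m} \<times> {..<n}"
  \<comment> \<open>Injectivity of the coding makes the colour of an edge that of its unique
    code.\<close>
  define b where "b e = torus_base (inv_into ?I (torus_edge m n) e)" for e
  note E = torus_edges_eq[OF mn(1,2)]
  have b: "b (torus_edge m n s) = torus_base s" if "s \<in> ?I" for s
    using that inv_into_f_f[OF inj_on_torus_edge[OF mn(1,2)]] by (simp add: b_def)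
  have "b e \<noteq> b f" if ef: "e \<in> torus_edges m n" "f \<in> torus_edges m n" "e \<noteq> f" "e \<inter> f \<noteq> {}" for e f
  proof -
    obtain s t where s: "s \<in> ?I" "e = torus_edge m n s" and t: "t \<in> ?I" "f = torus_edge m n t"
      using ef(1,2) unfolding E by (elim imageE)
    obtain x y where xy: "(x, y) \<in> e" "(x, y) \<in> f" using ef by auto
    have "x < m" "y < n"
      using torus_edge_subset[OF ef(1)] xy by (auto simp: torus_verts_def)
    from torus_base_distinct[OF mn this]
    have "inj_on torus_base (set [(True, x, y), (True, cyc_pred m x, y), (False, x, y), (False, x, cyc_pred n y)])"
      by (simp only: distinct_map)
    then have "inj_on torus_base {(True, x, y), (True, cyc_pred m x, y), (False, x, y), (False, x, cyc_pred n y)}"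
      by (simp only: list.set)
    moreover have "s \<in> {(True, x, y), (True, cyc_pred m x, y), (False, x, y), (False, x, cyc_pred n y)}"
      using torus_edge_incident s xy by (cases s) auto
    moreover have "t \<in> {(True, x, y), (True, cyc_pred m x, y), (False, x, y), (False, x, cyc_pred n y)}"
      using torus_edge_incident t xy by (cases t) auto
    ultimately show ?thesis
      using b s t ef(3) by (metis inj_onD)
  qed
  then have proper: "proper_edge_coloring (torus_edges m n) b"
    by (simp add: proper_edge_coloring_def)
  have range: "b ` torus_edges m n \<subseteq> {..<5}"
    using b E torus_base_less by auto
  have "b (torus_edge m n (False, 0, 0)) = 4"
    using mn b[of "(False, 0, 0)"] by (simp add: cyc_class_def)
  moreover have "\<exists>h\<in>torus_edges m n. x \<in> h \<and> h \<inter> torus_edge m n (False, 0, 0) \<noteq> {}"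
    if g: "g \<in> torus_edges m n" "b g = 4" "x \<in> g" for g x
  proof -
    obtain d i j where s: "(d, i, j) \<in> ?I" "g = torus_edge m n (d, i, j)" using g E by auto
    then have "torus_base (d, i, j) = 4" using b g by metis
    from torus_base_eq_4[OF this] have "x \<in> {(0, 0), (0, 1), (1, 0), (1, 1)}"
      using s g mn by auto
    \<comment> \<open>The rare colour lives on two opposite sides of a 4-cycle; the other two sides
      serve as \<open>h\<close>, since each meets the prescribed edge.\<close>
    then have "x \<in> torus_edge m n (True, 0, 0) \<or> x \<in> torus_edge m n (True, 0, 1)"
      using mn by auto
    moreover have "torus_edge m n (True, 0, 0) \<inter> torus_edge m n (False, 0, 0) \<noteq> {}"
      "torus_edge m n (True, 0, 1) \<inter> torus_edge m n (False, 0, 0) \<noteq> {}"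
      using mn by auto
    moreover have "torus_edge m n (True, 0, 0) \<in> torus_edges m n" "torus_edge m n (True, 0, 1) \<in> torus_edges m n"
      unfolding E using mn by (simp_all del: torus_edge.simps)
    ultimately show ?thesis by blast
  qed
  ultimately show ?thesis using that proper range unfolding focused_coloring_def by blast
qed

section \<open>Moving the rare colour by symmetries\<close>

lemma focused_coloring_vertical:
  assumes mn: "3 \<le> m" "3 \<le> n" "odd m" "odd n" and ij: "i < m" "j < n"
  obtains b where "focused_coloring (torus_edges m n) (torus_edge m n (False, i, j)) b"
proof -
  \<comment> \<open>The translation taking \<open>(i, j)\<close> to the origin; \<open>m - i\<close>
    and \<open>n - j\<close> stand for the negatives modulo \<open>m\<close> and
    \<open>n\<close>.\<close>
  define \<sigma> where "\<sigma> = (\<lambda>(x, y). ((x + (m - i)) mod m, (y + (n - j)) mod n))"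
  have \<sigma>: "\<sigma> ` torus_edge m n (d, x, y) = torus_edge m n (d, (x + (m - i)) mod m, (y + (n - j)) mod n)" for d x y
    by (cases d) (auto simp: \<sigma>_def mod_simps)
  have inj: "inj_on \<sigma> (torus_verts m n)"
  proof -
    have cancel: "x = x'" if "(x + a) mod k = (x' + a) mod k" "x < k" "x' < k" "a \<le> k" for x x' a k :: nat
      using that by (auto simp: mod_if split: if_splits)
    show ?thesis
    proof (rule inj_onI)
      fix u v assume uv: "u \<in> torus_verts m n" "v \<in> torus_verts m n" "\<sigma> u = \<sigma> v"
      show "u = v"
      proof (rule prod_eqI)
        show "fst u = fst v"
          by (rule cancel[of _ "m - i" m]) (use uv in \<open>auto simp: \<sigma>_def torus_verts_def split_def\<close>)
        show "snd u = snd v"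
          by (rule cancel[of _ "n - j" n]) (use uv in \<open>auto simp: \<sigma>_def torus_verts_def split_def\<close>)
      qed
    qed
  qed
  have sub: "\<Union> (torus_edges m n) \<subseteq> torus_verts m n"
    using torus_edge_subset by blast
  have "(`) \<sigma> ` torus_edges m n = torus_edges m n"
  \<comment> \<open>An injective self-map of a finite set is onto, so only one inclusion needs
    checking.\<close>
  proof (rule endo_inj_surj)
    show "finite (torus_edges m n)" using finite_torus_edges mn by blast
    show "(`) \<sigma> ` torus_edges m n \<subseteq> torus_edges m n"
      using mn \<sigma> by (auto simp: torus_edges_eq)
    show "inj_on ((`) \<sigma>) (torus_edges m n)"
      using inj_on_image[OF inj_on_subset[OF inj sub]] .
  qed
  moreover have "\<sigma> ` torus_edge m n (False, i, j) = torus_edge m n (False, 0, 0)"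
    unfolding \<sigma> using ij by simp
  moreover obtain b where "focused_coloring (torus_edges m n) (torus_edge m n (False, 0, 0)) b"
    using focused_coloring_at_origin mn by blast
  moreover have "torus_edge m n (False, i, j) \<in> torus_edges m n"
    unfolding torus_edges_eq[OF mn(1,2)] using ij by (intro imageI) simp
  ultimately show ?thesis
    using focused_coloring_transfer[of "torus_edges m n" \<sigma> "torus_edge m n (False, i, j)" b "torus_edges m n"]
      inj_on_subset[OF inj sub] that by simp
qed

text \<open>Swapping the two factors turns the remaining direction into the one already treated, on
  the torus with \<open>m\<close> and \<open>n\<close> exchanged.\<close>

lemma focused_coloring_torus:
  assumes mn: "3 \<le> m" "3 \<le> n" "odd m" "odd n" and e: "e \<in> torus_edges m n"
  obtains b where "focused_coloring (torus_edges m n) e b"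
proof -
  obtain d i j where d: "e = torus_edge m n (d, i, j)" "i < m" "j < n"
    using e torus_edges_eq mn by auto
  show ?thesis
  proof (cases d)
    case False
    then show ?thesis using that d focused_coloring_vertical mn by metis
  next
    case True
    have swap: "prod.swap ` torus_edge m n (d, x, y) = torus_edge n m (\<not> d, y, x)" for d x y and m n :: nat
      by (cases d) auto
    have "(`) prod.swap ` torus_edges m n = torus_edges n m"
    proof -
      \<comment> \<open>General in \<open>m\<close> and \<open>n\<close>: the swap is an involution,
        so the two inclusions together give equality.\<close>
      have sub: "(`) prod.swap ` torus_edges m n \<subseteq> torus_edges n m" if "3 \<le> m" "3 \<le> n" for m n
        using that swap by (auto simp: torus_edges_eq)
      have "(`) prod.swap ` (`) prod.swap ` torus_edges n m = torus_edges n m"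
        by (simp add: image_image)
      then show ?thesis using sub mn by (metis image_mono subset_antisym)
    qed
    moreover have "prod.swap ` e = torus_edge n m (False, j, i)" using d True swap by simp
    moreover obtain b where "focused_coloring (torus_edges n m) (torus_edge n m (False, j, i)) b"
      using focused_coloring_vertical mn d by metis
    ultimately show ?thesis
      using focused_coloring_transfer[of "torus_edges n m" prod.swap e b "torus_edges m n"] e that
      by (metis inj_on_subset inj_swap subset_UNIV)
  qed
qed

section \<open>Distances between edges\<close>

lemma torus_edge_adj:
  assumes "g \<in> graph_edges V (torus_adj m n)" "x \<in> g" "y \<in> g"
  shows "x = y \<or> torus_adj m n x y"
proof -
  have sym: "torus_adj m n v u" if "torus_adj m n u v" for u v
    using that unfolding torus_adj_def cart_adj_def cycle_adj_def by metis
  obtain u v where "g = {u, v}" "torus_adj m n u v"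
    using assms(1) unfolding graph_edges_def by blast
  then show ?thesis using assms(2,3) sym by blast
qed

lemma edge_dist_le:
  assumes "finite e" "finite f" "x \<in> e" "y \<in> f" "(adj ^^ k) x y"
  shows "edge_dist adj e f \<le> k"
proof -
  have "finite {graph_dist adj x y | x y. x \<in> e \<and> y \<in> f}"
    using assms(1,2) by (rule finite_image_set2[of "\<lambda>x. x \<in> e" "\<lambda>y. y \<in> f", simplified])
  then have "edge_dist adj e f \<le> graph_dist adj x y"
    unfolding edge_dist_def using assms(3,4) by (intro Min_le) auto
  also have "\<dots> \<le> k" unfolding graph_dist_def using assms(5) by (rule Least_le)
  finally show ?thesis .
qed

text \<open>A common vertex of \<open>g\<close> and \<open>g'\<close> is the midpoint of a walk from
  \<open>e\<close> to \<open>f\<close> with at most two steps, either of which may be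
  trivial.\<close>

lemma edge_dist_torus_le_2:
  assumes mn: "3 \<le> m" "3 \<le> n" and E: "e \<in> torus_edges m n" "f \<in> torus_edges m n"
    and g: "g \<in> torus_edges m n" "g' \<in> torus_edges m n" "g \<inter> e \<noteq> {}" "g' \<inter> f \<noteq> {}" "g \<inter> g' \<noteq> {}"
  shows "edge_dist (torus_adj m n) e f \<le> 2"
proof -
  let ?A = "torus_adj m n"
  have fin: "finite e" "finite f"
    using card_torus_edge E by (auto intro: card_ge_0_finite)
  obtain x y z where xyz: "x \<in> e" "x \<in> g" "y \<in> f" "y \<in> g'" "z \<in> g" "z \<in> g'" using g by blast
  then have "x = z \<or> ?A x z" "z = y \<or> ?A z y" using torus_edge_adj g by metis+
  then obtain q where "q \<le> 2" "(?A ^^ q) x y"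
  proof -
    have "(?A ^^ 0) x y \<or> (?A ^^ 1) x y \<or> (?A ^^ 2) x y"
      using \<open>x = z \<or> ?A x z\<close> \<open>z = y \<or> ?A z y\<close> by (auto simp: numeral_2_eq_2)
    then show ?thesis using that[of 0] that[of 1] that[of 2] by fastforce
  qed
  then show ?thesis using edge_dist_le[OF fin] xyz by (meson le_trans)
qed

section \<open>Extending the precoloring\<close>

theorem theorem4:
  fixes k l :: nat and E0 :: "(nat \<times> nat) set set" and \<phi> :: "(nat \<times> nat) set \<Rightarrow> nat"
  assumes "k \<ge> 1" and "l \<ge> 1"
    and "E0 \<subseteq> graph_edges (torus_verts (2*k+1) (2*l+1)) (torus_adj (2*k+1) (2*l+1))"
    and "card (\<phi> ` E0) \<le> 5"
    and "\<forall>e\<in>E0. \<forall>f\<in>E0. e \<noteq> f \<longrightarrow> edge_dist (torus_adj (2*k+1) (2*l+1)) e f \<ge> 3"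
  shows "\<exists>c :: (nat \<times> nat) set \<Rightarrow> nat.
    proper_edge_coloring (graph_edges (torus_verts (2*k+1) (2*l+1)) (torus_adj (2*k+1) (2*l+1))) c
    \<and> card (c ` graph_edges (torus_verts (2*k+1) (2*l+1)) (torus_adj (2*k+1) (2*l+1)))
        \<le> chromatic_index (graph_edges (torus_verts (2*k+1) (2*l+1)) (torus_adj (2*k+1) (2*l+1)))
    \<and> (\<forall>e\<in>E0. c e = \<phi> e)"
proof -
  define m n where "m = 2*k+1" and "n = 2*l+1"
  have mn: "3 \<le> m" "3 \<le> n" "odd m" "odd n" using assms(1,2) by (auto simp: m_def n_def)
  let ?E = "torus_edges m n"
  have sub: "E0 \<subseteq> ?E" and dist: "\<And>e f. \<lbrakk>e \<in> E0; f \<in> E0; e \<noteq> f\<rbrakk> \<Longrightarrow> edge_dist (torus_adj m n) e f \<ge> 3"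
    using assms(3,5) by (auto simp: m_def n_def)
  have sep: "g \<inter> g' = {}"
    if "e \<in> E0" "f \<in> E0" "e \<noteq> f" "g \<in> ?E" "g' \<in> ?E" "g \<inter> e \<noteq> {}" "g' \<inter> f \<noteq> {}" for e f g g'
    using edge_dist_torus_le_2[OF mn(1,2), of e f g g'] dist[of e f] that sub by fastforce
  \<comment> \<open>If nothing is precolored, any edge can carry the rare colour.\<close>
  obtain e1 where e1: "e1 \<in> ?E" "E0 \<noteq> {} \<longrightarrow> e1 \<in> E0"
  proof (cases "E0 = {}")
    case True
    have "torus_edge m n (True, 0, 0) \<in> ?E"
      unfolding torus_edges_eq[OF mn(1,2)] by (rule imageI) (use mn in simp)
    then show ?thesis using that True by blast
  next
    case False
    then show ?thesis using that sub by blast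
  qed
  obtain b where b: "focused_coloring ?E e1 b" using focused_coloring_torus mn e1(1) by metis
  have index: "5 \<le> chromatic_index ?E"
  proof -
    \<comment> \<open>A witness with five colours ensures that the least number in
      \<open>chromatic_index\<close> is attained, so the lower bound applies to it.\<close>
    have "\<exists>c :: (nat \<times> nat) set \<Rightarrow> nat. proper_edge_coloring ?E c \<and> c ` ?E \<subseteq> {..<5}"
      using b unfolding focused_coloring_def by blast
    then have "\<exists>c :: (nat \<times> nat) set \<Rightarrow> nat. proper_edge_coloring ?E c \<and> c ` ?E \<subseteq> {..<chromatic_index ?E}"
      unfolding chromatic_index_def by (rule LeastI)
    then show ?thesis using five_le_of_proper_torus_coloring mn by blast
  qed
  have finE0: "finite (\<phi> ` E0)" using finite_torus_edges[OF mn(1,2)] sub finite_subset by blast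
  obtain B where B: "finite B" "card B = 5 - card (\<phi> ` E0)" "B \<subseteq> - \<phi> ` E0"
    using infinite_arbitrarily_large[of "- \<phi> ` E0" "5 - card (\<phi> ` E0)"] finE0
    by (metis finite_compl infinite_UNIV_nat)
  \<comment> \<open>The prescribed colours are arbitrary naturals; fresh ones from \<open>B\<close>
    pad them to a palette of exactly five.\<close>
  define K where "K = \<phi> ` E0 \<union> B"
  have K: "\<phi> ` E0 \<subseteq> K" "finite K" "card K = 5"
    using B finE0 assms(4) card_Un_disjoint[of "\<phi> ` E0" B] by (auto simp: K_def)
  obtain v where v: "v \<in> K" "E0 \<noteq> {} \<longrightarrow> v = \<phi> e1"
    using K e1(2) by (cases "E0 = {}") fastforce+
  have "card (K - {v}) = card {..<4::nat}" using v K by simp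
  then obtain h where h: "bij_betw h {..<4::nat} (K - {v})"
    using K(2) by (metis finite_same_card_bij finite_lessThan finite_Diff)
  \<comment> \<open>Renames the colours below 5 to the palette \<open>K\<close>, sending the rare
    colour 4 to \<open>\<phi> e1\<close> when \<open>E0\<close> is nonempty.\<close>
  define \<pi> where "\<pi> = h(4 := v)"
  have "bij_betw \<pi> {..<4} (K - {v})"
    using h by (subst bij_betw_cong[of _ _ h]) (auto simp: \<pi>_def)
  then have "bij_betw \<pi> ({..<4} \<union> {4}) ((K - {v}) \<union> {\<pi> 4})"
    by (rule notIn_Un_bij_betw[rotated 2]) (auto simp: \<pi>_def)
  moreover have "{..<4} \<union> {4} = {..<5::nat}" by auto
  ultimately have \<pi>: "bij_betw \<pi> {..<5} K" "E0 \<noteq> {} \<longrightarrow> \<pi> 4 = \<phi> e1"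
    using v by (simp_all add: \<pi>_def insert_absorb)
  have \<pi>_eq: "\<pi> (b f) = \<pi> a \<longleftrightarrow> b f = a" if "f \<in> ?E" "a < 5" for f a
    using that b inj_on_eq_iff[OF bij_betw_imp_inj_on[OF \<pi>(1)], of "b f" a]
    unfolding focused_coloring_def by blast
  have b': "proper_edge_coloring ?E (\<pi> \<circ> b)" "\<And>g. g \<in> ?E \<Longrightarrow> \<pi> (b g) = \<pi> 4 \<Longrightarrow> b g = 4"
    using b \<pi>_eq by (auto simp: focused_coloring_def proper_edge_coloring_def image_subset_iff)
  obtain c where c: "proper_edge_coloring ?E c" "\<forall>e\<in>E0. c e = \<phi> e"
    "c ` ?E \<subseteq> insert (\<pi> 4) ((\<pi> \<circ> b) ` ?E \<union> \<phi> ` E0)"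
  proof (rule recolour[OF b'(1) sub sep, where z = "\<pi> 4" and \<phi> = \<phi>])
    fix g e g'
    assume g: "g \<in> ?E" "(\<pi> \<circ> b) g = \<pi> 4" "e \<in> E0" "(\<pi> \<circ> b) e \<noteq> \<phi> e" "g' \<in> ?E" "g' \<inter> e \<noteq> {}"
    \<comment> \<open>The edge \<open>e1\<close> already has its prescribed colour, so a wrongly
      colored \<open>e\<close> is a different member of \<open>E0\<close>.\<close>
    then have "e1 \<in> E0" "e \<noteq> e1" "b g = 4"
      using e1 \<pi>(2) b b'(2) by (auto simp: focused_coloring_def)
    show "g \<inter> g' = {}"
    proof (rule ccontr)
      assume "g \<inter> g' \<noteq> {}"
      then obtain x where x: "x \<in> g" "x \<in> g'" by blast
      then obtain h where "h \<in> ?E" "x \<in> h" "h \<inter> e1 \<noteq> {}"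
        using b g(1) \<open>b g = 4\<close> unfolding focused_coloring_def by blast
      then show False using sep[of e1 e h g'] \<open>e1 \<in> E0\<close> \<open>e \<noteq> e1\<close> g x by blast
    qed
  qed
  have "insert (\<pi> 4) ((\<pi> \<circ> b) ` ?E \<union> \<phi> ` E0) \<subseteq> K"
    using \<pi>(1) b K(1) by (auto simp: focused_coloring_def bij_betw_def)
  then have "card (c ` ?E) \<le> 5" using c(3) K card_mono[of K "c ` ?E"] by (metis subset_trans)
  then have "proper_edge_coloring ?E c \<and> card (c ` ?E) \<le> chromatic_index ?E \<and> (\<forall>e\<in>E0. c e = \<phi> e)"
    using c(1,2) index by linarith
  then show ?thesis unfolding m_def n_def by (intro exI[of _ c])
qed

end
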